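(* Let $n_1, k_1, n_2, k_2$ be positive integers with $n_1 k_2 = n_2 k_1$. Let $M_1$ be an $n_1 \times k_1$ matrix with non-negative entries with all row sums equal to $k_2$ and all column sums equal to $n_2$; let $M_2$ be an $n_2 \times k_2$ matrix with non-negative entries with all row sums equal to $k_1$ and all column sums equal to $n_1$. Let $M$ be the square $\{0,1\}$-matrix (of size $n_1k_2 \times n_2k_1$) whose nonzero entries are in the same positions as the nonzero entries of the tensor (Kronecker) product $M_1 \otimes M_2^T$. Then the bipartite graph with bipartite adjacency matrix $M$ has a perfect matching.
   Context: Here $\otimes$ is the usual tensor (Kronecker) product of matrices: the rows of $M_1\otimes M_2^T$ are indexed by pairs $(i,j)$ with $i\in[n_1]$, $j\in[k_2]$, the columns by pairs $(i',j')$ with $i'\in[k_1]$, $j'\in[n_2]$, and the entry is $(M_1)_{i,i'}\,(M_2)_{j',j}$. The bipartite graph with bipartite adjacency matrix $M$ has the rows of $M$ as left vertices, the columns of $M$ as right vertices, and a row is joined to a column iff the corresponding entry of $M$ is nonzero. *)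

theory Defs
  imports "Jordan_Normal_Form.Matrix"
begin

text \<open>
  The index pair \<open>(i, j)\<close> is flattened lexicographically to \<open>i * d + j\<close>, where \<open>d\<close> is the
  corresponding dimension of the second factor; see \<open>index_kronecker_mat\<close> below.
\<close>

definition kronecker_mat :: "'a::times mat \<Rightarrow> 'a mat \<Rightarrow> 'a mat" where
  "kronecker_mat A B =
     mat (dim_row A * dim_row B) (dim_col A * dim_col B)
       (\<lambda>(r, c). A $$ (r div dim_row B, c div dim_col B) * B $$ (r mod dim_row B, c mod dim_col B))"

lemma dim_kronecker_mat [simp]:
  "dim_row (kronecker_mat A B) = dim_row A * dim_row B"
  "dim_col (kronecker_mat A B) = dim_col A * dim_col B"
  by (simp_all add: kronecker_mat_def)

lemma flatten_index_less:
  fixes i j m d :: nat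
  assumes "i < m" "j < d"
  shows "i * d + j < m * d"
proof -
  have "i * d + j < Suc i * d"
    using assms(2) by simp
  also have "\<dots> \<le> m * d"
    using assms(1) by (intro mult_right_mono) auto
  finally show ?thesis .
qed

lemma index_kronecker_mat:
  assumes "i < dim_row A" "j < dim_row B" "i' < dim_col A" "j' < dim_col B"
  shows "kronecker_mat A B $$ (i * dim_row B + j, i' * dim_col B + j') = A $$ (i, i') * B $$ (j, j')"
  using assms flatten_index_less[OF assms(1,2)] flatten_index_less[OF assms(3,4)]
  by (simp add: kronecker_mat_def)

lemma index_kronecker_mat_transpose:
  assumes "M\<^sub>1 \<in> carrier_mat n\<^sub>1 k\<^sub>1" "M\<^sub>2 \<in> carrier_mat n\<^sub>2 k\<^sub>2"
    and "i < n\<^sub>1" "j < k\<^sub>2" "i' < k\<^sub>1" "j' < n\<^sub>2"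
  shows "kronecker_mat M\<^sub>1 (transpose_mat M\<^sub>2) $$ (i * k\<^sub>2 + j, i' * n\<^sub>2 + j')
           = M\<^sub>1 $$ (i, i') * M\<^sub>2 $$ (j', j)"
  using assms index_kronecker_mat[of i M\<^sub>1 j "transpose_mat M\<^sub>2" i' j'] by auto

text \<open>
  A graph is a pair of a vertex set and a set of edges, each edge being the set of its two ends.
  Row \<open>i\<close> of a matrix is the vertex \<open>Inl i\<close>, column \<open>j\<close> is the vertex \<open>Inr j\<close>.
\<close>

definition bipartite_graph_of_mat :: "'a::zero mat \<Rightarrow> (nat + nat) set \<times> (nat + nat) set set" where
  "bipartite_graph_of_mat M =
     ({..<dim_row M} <+> {..<dim_col M},
      {{Inl i, Inr j} | i j. i < dim_row M \<and> j < dim_col M \<and> M $$ (i, j) \<noteq> 0})"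

definition matching :: "'v set \<times> 'v set set \<Rightarrow> 'v set set \<Rightarrow> bool" where
  "matching G P \<longleftrightarrow> P \<subseteq> snd G \<and> pairwise disjnt P"

definition perfect_matching :: "'v set \<times> 'v set set \<Rightarrow> 'v set set \<Rightarrow> bool" where
  "perfect_matching G P \<longleftrightarrow> matching G P \<and> \<Union>P = fst G"

end

theory Submission
  imports Defs
begin

text \<open>
  All row sums and all column sums of the Kronecker product \<open>M\<^sub>1 \<otimes> M\<^sub>2\<^sup>T\<close> are equal: the row
  \<open>(i, j)\<close> sums to (row sum of \<open>M\<^sub>1\<close>) \<open>\<cdot>\<close> (column sum of \<open>M\<^sub>2\<close>) \<open>= k\<^sub>2 n\<^sub>1\<close>, the column
  \<open>(i', j')\<close> to (column sum of \<open>M\<^sub>1\<close>) \<open>\<cdot>\<close> (row sum of \<open>M\<^sub>2\<close>) \<open>= n\<^sub>2 k\<^sub>1\<close>, and these numbers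
  agree by hypothesis (\<open>row_sum_kronecker_mat\<close>, \<open>col_sum_kronecker_mat\<close>). So the product is a positive
  multiple of a doubly stochastic matrix. If \<open>s\<close> is the common sum, a set \<open>J\<close> of rows carries the total weight
  \<open>s |J|\<close>, all of it in the columns that meet the support of \<open>J\<close>; as each column carries only \<open>s\<close>,
  there are at least \<open>|J|\<close> such columns. This is Hall's condition, and a system of distinct
  representatives (\<open>hall_marriage\<close>) picks a nonzero entry in each row, no two in one column. There
  are as many rows as columns, so these entries form a perfect matching
  (\<open>doubly_stochastic_support_bij\<close>).
\<close>

section \<open>Systems of distinct representatives\<close>

text \<open>
  Suppose that deleting \<open>x\<close> from \<open>A i\<close> and deleting \<open>y\<close> from \<open>A i\<close> both destroy Hall's condition.
  The index sets that witness this contain \<open>i\<close>; without \<open>i\<close> they are \<open>J\<close> and \<open>K\<close> with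
  \<open>|A J \<union> (A i - {x})| \<le> |J|\<close> and \<open>|A K \<union> (A i - {y})| \<le> |K|\<close>, where \<open>A J\<close> is the union of the
  \<open>A j\<close> with \<open>j \<in> J\<close>. The union of the two left-hand sets is \<open>A (J \<union> K \<union> {i})\<close>, because
  \<open>x \<noteq> y\<close>, and their intersection contains \<open>A (J \<inter> K)\<close>, so Hall's condition for these two index
  sets gives \<open>|J \<union> K| + 1 + |J \<inter> K| \<le> |J| + |K|\<close>, which is absurd. This is Rado's argument.
\<close>

lemma hall_condition_delete:
  fixes A :: "'i \<Rightarrow> 'a set"
  assumes "finite I" and fin: "\<And>i. i \<in> I \<Longrightarrow> finite (A i)"
    and hall: "\<And>J. J \<subseteq> I \<Longrightarrow> card J \<le> card (\<Union>(A ` J))"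
    and "i \<in> I" "x \<noteq> y"
  obtains z where "z \<in> {x, y}"
    "\<And>J. J \<subseteq> I \<Longrightarrow> card J \<le> card (\<Union>((A(i := A i - {z})) ` J))"
proof (rule ccontr)
  note deletable = that
  assume *: "\<not> thesis"
  have fails: "\<exists>J\<subseteq>I. card (\<Union>((A(i := A i - {z})) ` J)) < card J" if z: "z \<in> {x, y}" for z
  proof (rule ccontr)
    assume "\<not> ?thesis"
    then have "thesis"
      using z by (intro deletable[of z]) (auto simp: not_less simp del: fun_upd_apply)
    with * show False ..
  qed
  have "\<exists>J. J \<subseteq> I - {i} \<and> card (\<Union>(A ` J) \<union> (A i - {z})) \<le> card J" if z: "z \<in> {x, y}" for z
  proof -
    obtain J where J: "J \<subseteq> I" "card (\<Union>((A(i := A i - {z})) ` J)) < card J"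
      using fails[OF z] by blast
    have "i \<in> J"
    proof (rule ccontr)
      assume "i \<notin> J"
      then have "\<Union>((A(i := A i - {z})) ` J) = \<Union>(A ` J)"
        by auto
      then show False
        using J hall[of J] by simp
    qed
    then have "\<Union>((A(i := A i - {z})) ` J) = \<Union>(A ` (J - {i})) \<union> (A i - {z})"
      by (auto split: if_splits)
    moreover have "card J = Suc (card (J - {i}))"
      using \<open>i \<in> J\<close> J(1) \<open>finite I\<close> by (meson card.remove finite_subset)
    ultimately show ?thesis
      using J by (intro exI[of _ "J - {i}"]) auto
  qed
  then obtain J K where J: "J \<subseteq> I - {i}" "card (\<Union>(A ` J) \<union> (A i - {x})) \<le> card J"
    and K: "K \<subseteq> I - {i}" "card (\<Union>(A ` K) \<union> (A i - {y})) \<le> card K"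
    by (metis insertI1 insertI2)
  define X Y where "X = \<Union>(A ` J) \<union> (A i - {x})" and "Y = \<Union>(A ` K) \<union> (A i - {y})"
  have finJK: "finite J" "finite K"
    using J(1) K(1) \<open>finite I\<close> by (meson finite_Diff finite_subset)+
  have finXY: "finite X" "finite Y"
    using J(1) K(1) finJK fin \<open>i \<in> I\<close> by (auto simp: X_def Y_def)
  have "X \<union> Y = \<Union>(A ` insert i (J \<union> K))"
    using \<open>x \<noteq> y\<close> by (auto simp: X_def Y_def)
  moreover have "insert i (J \<union> K) \<subseteq> I"
    using J(1) K(1) \<open>i \<in> I\<close> by auto
  ultimately have "card (insert i (J \<union> K)) \<le> card (X \<union> Y)"
    using hall by metis
  moreover have "card (insert i (J \<union> K)) = Suc (card (J \<union> K))"
    using J(1) K(1) finJK by (subst card_insert_disjoint) auto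
  moreover have "card (J \<inter> K) \<le> card (X \<inter> Y)"
  proof -
    have "card (J \<inter> K) \<le> card (\<Union>(A ` (J \<inter> K)))"
      using hall[of "J \<inter> K"] J(1) by auto
    also have "\<dots> \<le> card (X \<inter> Y)"
      using finXY by (intro card_mono) (auto simp: X_def Y_def)
    finally show ?thesis .
  qed
  moreover have "card J + card K = card (J \<union> K) + card (J \<inter> K)"
    using finJK by (rule card_Un_Int)
  moreover have "card X + card Y = card (X \<union> Y) + card (X \<inter> Y)"
    using finXY by (rule card_Un_Int)
  ultimately show False
    using J(2) K(2) by (simp add: X_def Y_def)
qed

text \<open>
  Elements are deleted one at a time, as \<open>hall_condition_delete\<close> permits, until no set of the family
  has two elements. Hall's condition then makes the sets disjoint singletons.
\<close>

theorem hall_marriage: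
  fixes A :: "'i \<Rightarrow> 'a set"
  assumes "finite I" and "\<And>i. i \<in> I \<Longrightarrow> finite (A i)"
    and "\<And>J. J \<subseteq> I \<Longrightarrow> card J \<le> card (\<Union>(A ` J))"
  shows "\<exists>f. inj_on f I \<and> (\<forall>i\<in>I. f i \<in> A i)"
  using assms(2,3)
proof (induction "\<Sum>i\<in>I. card (A i)" arbitrary: A rule: less_induct)
  case less
  show ?case
  proof (cases "\<exists>i\<in>I. \<exists>x\<in>A i. \<exists>y\<in>A i. x \<noteq> y")
    case True
    then obtain i x y where i: "i \<in> I" "x \<in> A i" "y \<in> A i" "x \<noteq> y"
      by blast
    obtain z where z: "z \<in> {x, y}"
      "\<And>J. J \<subseteq> I \<Longrightarrow> card J \<le> card (\<Union>((A(i := A i - {z})) ` J))"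
      using hall_condition_delete[OF \<open>finite I\<close> less.prems(1,2) i(1,4)] by metis
    let ?B = "A(i := A i - {z})"
    have "z \<in> A i"
      using z(1) i by auto
    then have "(\<Sum>j\<in>I. card (?B j)) < (\<Sum>j\<in>I. card (A j))"
      using \<open>finite I\<close> i(1) less.prems(1)
      by (intro sum_strict_mono_ex1 bexI[of _ i])
        (auto simp: card_Diff1_le card_Diff1_less simp del: card_Diff_insert)
    moreover have "finite (?B j)" if "j \<in> I" for j
      using less.prems(1) that i(1) by auto
    ultimately obtain f where "inj_on f I" "\<forall>j\<in>I. f j \<in> ?B j"
      using less.hyps[of ?B] z(2) by blast
    then show ?thesis
      by (auto split: if_splits)
  next
    case False
    have "A i \<noteq> {}" if "i \<in> I" for i
      using less.prems(2)[of "{i}"] that by auto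
    then obtain f where f: "\<And>i. i \<in> I \<Longrightarrow> f i \<in> A i"
      by (meson ex_in_conv)
    with False have A: "A i = {f i}" if "i \<in> I" for i
      using that by blast
    have "inj_on f I"
    proof (rule inj_onI, rule ccontr)
      fix i j assume ij: "i \<in> I" "j \<in> I" "f i = f j" "i \<noteq> j"
      then show False
        using less.prems(2)[of "{i, j}"] A by auto
    qed
    with f show ?thesis
      by blast
  qed
qed

section \<open>Supports of doubly stochastic matrices\<close>

text \<open>
  Hall's condition for the supports of the rows: the rows in \<open>J\<close> have total weight \<open>s |J|\<close>, and this
  is at most the weight \<open>s |N J|\<close> of the columns that their supports meet.
\<close>

lemma doubly_stochastic_support_bij:
  fixes w :: "'r \<Rightarrow> 'c \<Rightarrow> real"
  assumes "finite R" "finite C" "s > 0"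
    and nonneg: "\<And>r c. r \<in> R \<Longrightarrow> c \<in> C \<Longrightarrow> w r c \<ge> 0"
    and row: "\<And>r. r \<in> R \<Longrightarrow> (\<Sum>c\<in>C. w r c) = s"
    and col: "\<And>c. c \<in> C \<Longrightarrow> (\<Sum>r\<in>R. w r c) = s"
  obtains f where "bij_betw f R C" "\<And>r. r \<in> R \<Longrightarrow> w r (f r) \<noteq> 0"
proof -
  define N where "N r = {c \<in> C. w r c \<noteq> 0}" for r
  have "card J \<le> card (\<Union>(N ` J))" if J: "J \<subseteq> R" for J
  proof -
    let ?N = "\<Union>(N ` J)"
    have sub: "?N \<subseteq> C"
      by (auto simp: N_def)
    have finJ: "finite J"
      using J \<open>finite R\<close> by (rule finite_subset)
    have "s * card J = (\<Sum>r\<in>J. \<Sum>c\<in>C. w r c)"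
      using row J by (simp add: subset_iff)
    also have "\<dots> = (\<Sum>r\<in>J. \<Sum>c\<in>?N. w r c)"
      using sub \<open>finite C\<close>
      by (intro sum.cong refl sum.mono_neutral_right) (auto simp: N_def)
    also have "\<dots> = (\<Sum>c\<in>?N. \<Sum>r\<in>J. w r c)"
      by (rule sum.swap)
    also have "\<dots> \<le> (\<Sum>c\<in>?N. \<Sum>r\<in>R. w r c)"
      using J sub \<open>finite R\<close> nonneg by (intro sum_mono sum_mono2) auto
    also have "\<dots> = s * card ?N"
      using col sub by (simp add: subset_iff)
    finally show ?thesis
      using \<open>s > 0\<close> by simp
  qed
  moreover have "finite (N r)" for r
    using \<open>finite C\<close> by (simp add: N_def)
  ultimately obtain f where f: "inj_on f R" "\<forall>r\<in>R. f r \<in> N r"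
    using hall_marriage[OF \<open>finite R\<close>, of N] by blast
  \<comment> \<open>An injection from \<open>R\<close> to \<open>C\<close> is onto because the total weight, counted by rows and by
      columns, forces \<open>|R| = |C|\<close>.\<close>
  have "s * card R = (\<Sum>r\<in>R. \<Sum>c\<in>C. w r c)"
    using row by simp
  also have "\<dots> = (\<Sum>c\<in>C. \<Sum>r\<in>R. w r c)"
    by (rule sum.swap)
  also have "\<dots> = s * card C"
    using col by simp
  finally have "card R = card C"
    using \<open>s > 0\<close> by simp
  moreover have "f ` R \<subseteq> C"
    using f(2) by (auto simp: N_def)
  ultimately have "f ` R = C"
    using \<open>finite C\<close> f(1) by (intro card_subset_eq) (auto simp: card_image)
  then show ?thesis
    using f by (intro that[of f]) (auto simp: bij_betw_def N_def)
qed

section \<open>Row and column sums of Kronecker products\<close>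

lemma sum_mult_div_mod:
  fixes f g :: "nat \<Rightarrow> 'a::comm_semiring_0"
  shows "(\<Sum>c<m * n. f (c div n) * g (c mod n)) = (\<Sum>i<m. f i) * (\<Sum>j<n. g j)"
proof -
  have "(\<Sum>c<m * n. f (c div n) * g (c mod n)) = (\<Sum>(i, j)\<in>{..<m} \<times> {..<n}. f i * g j)"
  proof (cases "n = 0")
    case False
    then show ?thesis
      by (intro sum.reindex_bij_witness[of _ "\<lambda>(i, j). i * n + j" "\<lambda>c. (c div n, c mod n)"])
        (auto simp: less_mult_imp_div_less flatten_index_less)
  qed simp
  then show ?thesis
    by (simp add: sum_product sum.cartesian_product)
qed

lemma row_sum_kronecker_mat:
  fixes A B :: "'a::comm_semiring_0 mat"
  assumes "r < dim_row A * dim_row B"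
  shows "(\<Sum>c<dim_col A * dim_col B. kronecker_mat A B $$ (r, c)) =
    (\<Sum>i<dim_col A. A $$ (r div dim_row B, i)) * (\<Sum>j<dim_col B. B $$ (r mod dim_row B, j))"
  using assms by (simp add: kronecker_mat_def flip: sum_mult_div_mod)

lemma col_sum_kronecker_mat:
  fixes A B :: "'a::comm_semiring_0 mat"
  assumes "c < dim_col A * dim_col B"
  shows "(\<Sum>r<dim_row A * dim_row B. kronecker_mat A B $$ (r, c)) =
    (\<Sum>i<dim_row A. A $$ (i, c div dim_col B)) * (\<Sum>j<dim_row B. B $$ (j, c mod dim_col B))"
  using assms by (simp add: kronecker_mat_def flip: sum_mult_div_mod)

section \<open>Perfect matchings\<close>

lemma perfect_matching_of_bij:
  assumes bij: "bij_betw f {..<dim_row M} {..<dim_col M}"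
    and nz: "\<And>r. r < dim_row M \<Longrightarrow> M $$ (r, f r) \<noteq> 0"
  shows "perfect_matching (bipartite_graph_of_mat M) ((\<lambda>r. {Inl r, Inr (f r)}) ` {..<dim_row M})"
proof -
  have less: "f r < dim_col M" if "r < dim_row M" for r
    using bij_betwE[OF bij] that by simp
  have img: "f ` {..<dim_row M} = {..<dim_col M}"
    using bij by (rule bij_betw_imp_surj_on)
  have inj: "f r = f r' \<longleftrightarrow> r = r'" if "r < dim_row M" "r' < dim_row M" for r r'
    using bij_betw_imp_inj_on[OF bij] that by (auto simp: inj_on_def)
  have "\<Union>((\<lambda>r. {Inl r, Inr (f r)}) ` {..<dim_row M}) =
      Inl ` {..<dim_row M} \<union> Inr ` f ` {..<dim_row M}"
    by auto
  then show ?thesis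
    unfolding perfect_matching_def matching_def bipartite_graph_of_mat_def
    using nz less inj by (fastforce simp: img Plus_def pairwise_def disjnt_def)
qed

theorem theorem1:
  fixes n\<^sub>1 k\<^sub>1 n\<^sub>2 k\<^sub>2 :: nat
    and M\<^sub>1 M\<^sub>2 M :: "real mat"
  assumes "n\<^sub>1 > 0" and "k\<^sub>1 > 0" and "n\<^sub>2 > 0" and "k\<^sub>2 > 0"
    and "n\<^sub>1 * k\<^sub>2 = n\<^sub>2 * k\<^sub>1"
    and "M\<^sub>1 \<in> carrier_mat n\<^sub>1 k\<^sub>1"
    and "\<And>i j. i < n\<^sub>1 \<Longrightarrow> j < k\<^sub>1 \<Longrightarrow> M\<^sub>1 $$ (i, j) \<ge> 0"
    and "\<And>i. i < n\<^sub>1 \<Longrightarrow> (\<Sum>j<k\<^sub>1. M\<^sub>1 $$ (i, j)) = real k\<^sub>2"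
    and "\<And>j. j < k\<^sub>1 \<Longrightarrow> (\<Sum>i<n\<^sub>1. M\<^sub>1 $$ (i, j)) = real n\<^sub>2"
    and "M\<^sub>2 \<in> carrier_mat n\<^sub>2 k\<^sub>2"
    and "\<And>i j. i < n\<^sub>2 \<Longrightarrow> j < k\<^sub>2 \<Longrightarrow> M\<^sub>2 $$ (i, j) \<ge> 0"
    and "\<And>i. i < n\<^sub>2 \<Longrightarrow> (\<Sum>j<k\<^sub>2. M\<^sub>2 $$ (i, j)) = real k\<^sub>1"
    and "\<And>j. j < k\<^sub>2 \<Longrightarrow> (\<Sum>i<n\<^sub>2. M\<^sub>2 $$ (i, j)) = real n\<^sub>1"
    and "M \<in> carrier_mat (n\<^sub>1 * k\<^sub>2) (n\<^sub>2 * k\<^sub>1)"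
    and "\<And>r c. r < n\<^sub>1 * k\<^sub>2 \<Longrightarrow> c < n\<^sub>2 * k\<^sub>1 \<Longrightarrow> M $$ (r, c) \<in> {0, 1}"
    and "\<And>r c. r < n\<^sub>1 * k\<^sub>2 \<Longrightarrow> c < n\<^sub>2 * k\<^sub>1 \<Longrightarrow>
           M $$ (r, c) \<noteq> 0 \<longleftrightarrow> kronecker_mat M\<^sub>1 (transpose_mat M\<^sub>2) $$ (r, c) \<noteq> 0"
  shows "\<exists>P. perfect_matching (bipartite_graph_of_mat M) P"
proof -
  let ?K = "kronecker_mat M\<^sub>1 (transpose_mat M\<^sub>2)"
  have dims: "dim_row M\<^sub>1 = n\<^sub>1" "dim_col M\<^sub>1 = k\<^sub>1" "dim_row M\<^sub>2 = n\<^sub>2" "dim_col M\<^sub>2 = k\<^sub>2"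
    "dim_row M = n\<^sub>1 * k\<^sub>2" "dim_col M = k\<^sub>1 * n\<^sub>2"
    using assms by auto
  have index: "r div k\<^sub>2 < n\<^sub>1" "r mod k\<^sub>2 < k\<^sub>2" if "r < n\<^sub>1 * k\<^sub>2" for r
    using that \<open>k\<^sub>2 > 0\<close> by (auto simp: less_mult_imp_div_less)
  have index': "c div n\<^sub>2 < k\<^sub>1" "c mod n\<^sub>2 < n\<^sub>2" if "c < k\<^sub>1 * n\<^sub>2" for c
    using that \<open>n\<^sub>2 > 0\<close> by (auto simp: less_mult_imp_div_less)
  have nonneg: "?K $$ (r, c) \<ge> 0" if "r < n\<^sub>1 * k\<^sub>2" "c < k\<^sub>1 * n\<^sub>2" for r c
    using that index[of r] index'[of c] assms(7,11) by (simp add: kronecker_mat_def dims)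
  have row: "(\<Sum>c<k\<^sub>1 * n\<^sub>2. ?K $$ (r, c)) = real (n\<^sub>1 * k\<^sub>2)" if "r < n\<^sub>1 * k\<^sub>2" for r
    using row_sum_kronecker_mat[of r M\<^sub>1 "transpose_mat M\<^sub>2"] that index[of r] assms(8,13)
    by (simp add: dims)
  have col: "(\<Sum>r<n\<^sub>1 * k\<^sub>2. ?K $$ (r, c)) = real (n\<^sub>1 * k\<^sub>2)" if "c < k\<^sub>1 * n\<^sub>2" for c
    using col_sum_kronecker_mat[of c M\<^sub>1 "transpose_mat M\<^sub>2"] that index'[of c] assms(5,9,12)
    by (simp add: dims flip: of_nat_mult)
  have "real (n\<^sub>1 * k\<^sub>2) > 0"
    using assms(1,4) by simp
  then obtain f where f: "bij_betw f {..<n\<^sub>1 * k\<^sub>2} {..<k\<^sub>1 * n\<^sub>2}"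
    "\<And>r. r < n\<^sub>1 * k\<^sub>2 \<Longrightarrow> ?K $$ (r, f r) \<noteq> 0"
    using doubly_stochastic_support_bij[of "{..<n\<^sub>1 * k\<^sub>2}" "{..<k\<^sub>1 * n\<^sub>2}" "real (n\<^sub>1 * k\<^sub>2)"
        "\<lambda>r c. ?K $$ (r, c)"] nonneg row col
    by (metis finite_lessThan lessThan_iff)
  have "M $$ (r, f r) \<noteq> 0" if "r < n\<^sub>1 * k\<^sub>2" for r
    using f that bij_betwE[OF f(1)] assms(16)[of r "f r"] by (simp add: mult.commute)
  then show ?thesis
    using perfect_matching_of_bij[of f M] f(1) by (auto simp: dims)
qed

end
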